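(* Let $K$ be a nonempty compact subset of $X$ and let $F:X\to 2^Y$ be a set-valued mapping. Assume that $F$ is $-C$-lower semicontinuous and strictly $p$-$C$-convexlike on $K$ with nonempty, $-C$-convex and $-C$-compact values. Then the weak $p$-minimal solution set $W_p(F,K)$ is arcwise connected. Moreover, the $p$-minimal solution set $E_p(F,K)$ is arcwise connected.
   Context: $X$ is a (real) normed vector space, $Y$ is a (real) Banach space, and $C\subseteq Y$ is a convex, closed, pointed cone with nonempty interior $\operatorname{int}C$. For nonempty $A,B\subseteq Y$: $A\le^p B$ means that either $A=B$ or $\left(\bigcap_{a\in A}(a+C)\right)\cap B\neq\emptyset$; $A\ll^p B$ means $\left(\bigcap_{a\in A}(a+C)+\operatorname{int}C\right)\cap B\neq\emptyset$. $E_p(F,K)$ is the set of $x_0\in K$ such that for every $x\in K$, $F(x)\le^p F(x_0)$ implies $F(x_0)\le^p F(x)$. $W_p(F,K)$ is the set of $x_0\in K$ such that for every $x\in K$, $F(x)\ll^p F(x_0)$ implies $F(x_0)\ll^p F(x)$. $F$ is strictly $p$-$C$-convexlike on $K$ if for any $x_1,x_2\in K$ with $x_1\neq x_2$ and any $t\in(0,1)$ there exists $x_3\in K$ such that $F(x_3)\ll^p tF(x_1)+(1-t)F(x_2)$. A set $A\subseteq Y$ is $-C$-convex if $A-C$ is convex, and $-C$-compact if any cover of $A$ of the form $\{U_\alpha-C: U_\alpha \text{ open}\}$ admits a finite subcover. "With ... values" means that $F(x)$ has the stated properties for $x\in K$. $F$ is $-C$-lower semicontinuous at $u_0$ if for any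 $x\in F(u_0)$ and any neighborhood $V$ of $x$ there is a neighborhood $U(u_0)$ of $u_0$ such that $F(u)\cap(V+C)\neq\emptyset$ for every $u\in U(u_0)$; it is so on $K$ if it is so at each point of $K$. A nonempty set $A$ in a topological space is arcwise connected if for every $x,y\in A$ there is a continuous mapping $\varphi:[0,1]\to A$ with $\varphi(0)=x$ and $\varphi(1)=y$. *)

theory Defs
  imports "HOL-Analysis.Analysis" "HOL-Library.Set_Algebras"
begin

(* Throughout, sums of sets are the Minkowski sums of Set_Algebras. Since "A - C" on sets
   is set difference, the Minkowski difference of A and C is written "A + uminus ` C". *)

definition pointed :: "'b::real_vector set \<Rightarrow> bool" where
  "pointed C \<longleftrightarrow> C \<inter> uminus ` C = {0}"

definition p_le :: "'b::real_normed_vector set \<Rightarrow> 'b set \<Rightarrow> 'b set \<Rightarrow> bool" where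
  "p_le C A B \<longleftrightarrow> A = B \<or> (\<Inter>a\<in>A. (+) a ` C) \<inter> B \<noteq> {}"

(* The intersection is formed first and "interior C" is added to the result. *)
definition p_less :: "'b::real_normed_vector set \<Rightarrow> 'b set \<Rightarrow> 'b set \<Rightarrow> bool" where
  "p_less C A B \<longleftrightarrow> ((\<Inter>a\<in>A. (+) a ` C) + interior C) \<inter> B \<noteq> {}"

definition p_minimal :: "'b::real_normed_vector set \<Rightarrow> ('a \<Rightarrow> 'b set) \<Rightarrow> 'a set \<Rightarrow> 'a set" where
  "p_minimal C F K = {x0 \<in> K. \<forall>x\<in>K. p_le C (F x) (F x0) \<longrightarrow> p_le C (F x0) (F x)}"

definition weak_p_minimal :: "'b::real_normed_vector set \<Rightarrow> ('a \<Rightarrow> 'b set) \<Rightarrow> 'a set \<Rightarrow> 'a set" where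
  "weak_p_minimal C F K = {x0 \<in> K. \<forall>x\<in>K. p_less C (F x) (F x0) \<longrightarrow> p_less C (F x0) (F x)}"

definition strictly_p_convexlike_on ::
    "'b::real_normed_vector set \<Rightarrow> ('a \<Rightarrow> 'b set) \<Rightarrow> 'a set \<Rightarrow> bool" where
  "strictly_p_convexlike_on C F K \<longleftrightarrow>
     (\<forall>x1\<in>K. \<forall>x2\<in>K. \<forall>t::real. x1 \<noteq> x2 \<and> 0 < t \<and> t < 1 \<longrightarrow>
        (\<exists>x3\<in>K. p_less C (F x3) ((*\<^sub>R) t ` F x1 + (*\<^sub>R) (1 - t) ` F x2)))"

definition neg_cone_convex :: "'b::real_vector set \<Rightarrow> 'b set \<Rightarrow> bool" where
  "neg_cone_convex C A \<longleftrightarrow> convex (A + uminus ` C)"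

definition neg_cone_compact :: "'b::real_normed_vector set \<Rightarrow> 'b set \<Rightarrow> bool" where
  "neg_cone_compact C A \<longleftrightarrow>
     (\<forall>\<U>. (\<forall>U\<in>\<U>. open U) \<and> A \<subseteq> (\<Union>U\<in>\<U>. U + uminus ` C) \<longrightarrow>
        (\<exists>\<V>. \<V> \<subseteq> \<U> \<and> finite \<V> \<and> A \<subseteq> (\<Union>U\<in>\<V>. U + uminus ` C)))"

(* Open neighborhoods suffice, as every neighborhood contains an open one. The neighborhood N
   is taken in the whole domain space of F, also when lower semicontinuity is only required at
   the points of a subset K. *)
definition neg_cone_lsc_at ::
    "'b::real_normed_vector set \<Rightarrow> ('a::topological_space \<Rightarrow> 'b set) \<Rightarrow> 'a \<Rightarrow> bool" where
  "neg_cone_lsc_at C F u0 \<longleftrightarrow>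
     (\<forall>x\<in>F u0. \<forall>V. open V \<and> x \<in> V \<longrightarrow>
        (\<exists>N. open N \<and> u0 \<in> N \<and> (\<forall>u\<in>N. F u \<inter> (V + C) \<noteq> {})))"

definition neg_cone_lsc_on ::
    "'b::real_normed_vector set \<Rightarrow> ('a::topological_space \<Rightarrow> 'b set) \<Rightarrow> 'a set \<Rightarrow> bool" where
  "neg_cone_lsc_on C F K \<longleftrightarrow> (\<forall>u0\<in>K. neg_cone_lsc_at C F u0)"

(* The library's path_connected is vacuously true for the empty set, which is excluded here;
   its "arc" would require injective paths, which is not wanted. *)
definition arcwise_connected :: "'a::topological_space set \<Rightarrow> bool" where
  "arcwise_connected A \<longleftrightarrow> A \<noteq> {} \<and> path_connected A"

end

theory Submission
  imports Defs
begin

text \<open>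
  Fix \<open>e\<close> in the interior of \<open>C\<close>. A convex, \<open>C\<close>-monotone function \<open>\<psi>\<close> with
  \<open>\<psi> (y + r e) = \<psi> y + r\<close> turns \<open>F\<close> into the lower semicontinuous function
  \<open>x \<mapsto> sup \<psi> (F x)\<close>, whose minimiser on \<open>K\<close> is unique by strict convexlikeness and weakly
  minimal. Conversely, a weakly minimal \<open>x\<^sub>0\<close> is the minimiser belonging to the Gerstewitz
  functional \<open>\<psi>\<close> of \<open>F x\<^sub>0\<close>: strict convexlikeness and convexity of \<open>F x\<^sub>0 - C\<close> exclude
  \<open>F x \<subseteq> F x\<^sub>0 - C\<close> for every other \<open>x\<close>. Two such functionals \<open>\<psi>\<^sub>0\<close>, \<open>\<psi>\<^sub>1\<close> have a bounded
  difference, so the minimiser belonging to \<open>(1 - s) \<psi>\<^sub>0 + s \<psi>\<^sub>1\<close> depends continuously on \<open>s\<close>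
  and is a path of weakly minimal points. Finally, strict convexlikeness forces both solution
  sets to coincide.
\<close>

section \<open>Minimisers of lower semicontinuous functions\<close>

text \<open>The bound is required only on \<open>K\<close>, since the values
  \<open>worst \<psi> u\<close> studied below are controlled only for \<open>u\<close> in
  \<open>K\<close>.\<close>

definition lsc_on :: "'a::topological_space set \<Rightarrow> ('a \<Rightarrow> real) \<Rightarrow> bool" where
  "lsc_on K g \<longleftrightarrow> (\<forall>x\<in>K. \<forall>r<g x. \<exists>N. open N \<and> x \<in> N \<and> (\<forall>u\<in>N \<inter> K. r < g u))"

lemma lsc_on_subset:
  assumes "lsc_on K g" "L \<subseteq> K"
  shows "lsc_on L g"
  unfolding lsc_on_def
proof (intro ballI allI impI)
  fix x r assume "x \<in> L" "r < g x"
  with assms obtain N where "open N" "x \<in> N" "\<forall>u\<in>N \<inter> K. r < g u"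
    unfolding lsc_on_def by (meson subsetD)
  with assms(2) show "\<exists>N. open N \<and> x \<in> N \<and> (\<forall>u\<in>N \<inter> L. r < g u)"
    by (intro exI[of _ N]) auto
qed

text \<open>Without a minimum, the open sets \<open>N y\<close>, on which \<open>g\<close> exceeds
  \<open>g y\<close> within \<open>K\<close>, cover \<open>K\<close>. In a finite subcover the index
  with least value cannot itself be covered.\<close>

lemma lsc_on_attains_inf:
  assumes "compact K" "K \<noteq> {}" "lsc_on K g"
  shows "\<exists>x\<in>K. \<forall>y\<in>K. g x \<le> g y"
proof (rule ccontr)
  assume "\<not> ?thesis"
  then have lower: "\<forall>x\<in>K. \<exists>y\<in>K. g y < g x" by (meson not_le)
  \<comment> \<open>Taking the largest open set with this property avoids choosing a neighbourhood
    for each point.\<close>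
  define N where "N y = \<Union>{N. open N \<and> (\<forall>u\<in>N \<inter> K. g y < g u)}" for y
  have N_open: "open (N y)" for y unfolding N_def by blast
  have N_greater: "g y < g u" if "u \<in> N y" "u \<in> K" for u y
    using that unfolding N_def by blast
  have "K \<subseteq> (\<Union>y\<in>K. N y)"
  proof
    fix x assume x: "x \<in> K"
    with lower obtain y where y: "y \<in> K" "g y < g x" by blast
    with assms(3) x obtain M where "open M" "x \<in> M" "\<forall>u\<in>M \<inter> K. g y < g u"
      unfolding lsc_on_def by blast
    then have "x \<in> N y" unfolding N_def by blast
    with y show "x \<in> (\<Union>y\<in>K. N y)" by blast
  qed
  with assms(1) N_open obtain D where D: "D \<subseteq> K" "finite D" "K \<subseteq> (\<Union>y\<in>D. N y)"
    by (metis compactE_image)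
  with assms(2) have "D \<noteq> {}" by blast
  with D(2) obtain d where d: "d \<in> D" "\<forall>y\<in>D. g d \<le> g y"
    by (metis arg_min_if_finite(1) arg_min_least)
  with D obtain y where "y \<in> D" "d \<in> N y" by blast
  with N_greater[of d y] d D(1) show False by force
qed

text \<open>Outside a neighbourhood \<open>V\<close> of \<open>m s\<close>, the values of
  \<open>g s\<close> stay above the minimum by a gap \<open>d\<close>. Passing from \<open>s\<close>
  to a close \<open>t\<close> and back costs less than \<open>d\<close>, so \<open>m t\<close>
  cannot leave \<open>V\<close>.\<close>

lemma continuous_on_argmin:
  fixes g :: "real \<Rightarrow> 'a::t2_space \<Rightarrow> real"
  assumes "compact K"
    and lsc: "\<And>s. s \<in> S \<Longrightarrow> lsc_on K (g s)"
    and min: "\<And>s. s \<in> S \<Longrightarrow> m s \<in> K \<and> (\<forall>x\<in>K. x \<noteq> m s \<longrightarrow> g s (m s) < g s x)"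
    and lipschitz: "\<And>s t x. s \<in> S \<Longrightarrow> t \<in> S \<Longrightarrow> x \<in> K \<Longrightarrow> g s x \<le> g t x + M * \<bar>s - t\<bar>"
  shows "continuous_on S m"
  unfolding continuous_on_topological
proof (intro ballI allI impI)
  fix s V assume s: "s \<in> S" and V: "open V" "m s \<in> V"
  show "\<exists>A. open A \<and> s \<in> A \<and> (\<forall>t\<in>S. t \<in> A \<longrightarrow> m t \<in> V)"
  proof (cases "K - V = {}")
    case True
    then show ?thesis using min by (intro exI[of _ UNIV]) auto
  next
    case False
    have "compact (K - V)" using assms(1) V(1) by (simp add: compact_diff)
    moreover have "lsc_on (K - V) (g s)" using lsc[OF s] by (rule lsc_on_subset) auto
    ultimately obtain x where x: "x \<in> K - V" "\<forall>y\<in>K - V. g s x \<le> g s y"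
      using lsc_on_attains_inf False by metis
    define d where "d = g s x - g s (m s)"
    have d: "d > 0" unfolding d_def using min[OF s] x(1) V(2) by auto
    \<comment> \<open>\<open>M\<close> may be zero or negative; a positive bound is needed to divide
      by. The factor 2 in the radius pays for two uses of \<open>lipschitz\<close>.\<close>
    define L where "L = \<bar>M\<bar> + 1"
    have L: "L > 0" "M \<le> L" unfolding L_def by auto
    have "m t \<in> V" if t: "t \<in> S" "\<bar>s - t\<bar> < d / (2 * L)" for t
    proof (rule ccontr)
      assume "m t \<notin> V"
      then have "g s x \<le> g s (m t)" using x(2) min[OF t(1)] by auto
      also have "\<dots> \<le> g t (m t) + M * \<bar>s - t\<bar>" using lipschitz s t(1) min[OF t(1)] by auto
      also have "g t (m t) \<le> g t (m s)" using min[OF t(1)] min[OF s] by force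
      also have "g t (m s) \<le> g s (m s) + M * \<bar>s - t\<bar>"
        using lipschitz[OF t(1) s] min[OF s] by (metis abs_minus_commute)
      finally have "d \<le> 2 * (M * \<bar>s - t\<bar>)" unfolding d_def by simp
      also have "\<dots> \<le> 2 * (L * \<bar>s - t\<bar>)" using L(2) by (simp add: mult_right_mono)
      finally show False using t(2) L(1) by (simp add: field_simps)
    qed
    moreover have "open {t. \<bar>s - t\<bar> < d / (2 * L)}"
      by (intro open_Collect_less continuous_intros)
    ultimately show ?thesis using d L
      by (intro exI[of _ "{t. \<bar>s - t\<bar> < d / (2 * L)}"]) auto
  qed
qed

section \<open>Scalarisation by monotone convex functions\<close>

lemma neg_cone_sum_iff: "y \<in> A + uminus ` C \<longleftrightarrow> (\<exists>a\<in>A. a - y \<in> C)"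
  for y :: "'b::real_vector"
proof
  assume "y \<in> A + uminus ` C"
  then obtain a c where "a \<in> A" "c \<in> C" "y = a + (- c)" by (auto elim!: set_plus_elim)
  then show "\<exists>a\<in>A. a - y \<in> C" by (intro bexI[of _ a]) auto
next
  assume "\<exists>a\<in>A. a - y \<in> C"
  then obtain a where "a \<in> A" "a - y \<in> C" by blast
  then have "a + - (a - y) \<in> A + uminus ` C" by (intro set_plus_intro imageI)
  then show "y \<in> A + uminus ` C" by simp
qed

lemma p_le_iff: "p_le C A B \<longleftrightarrow> A = B \<or> (\<exists>b\<in>B. \<forall>a\<in>A. b - a \<in> C)"
proof -
  have "b \<in> (+) a ` C \<longleftrightarrow> b - a \<in> C" for a b :: 'a
    by (auto simp: image_iff intro!: bexI[of _ "b - a"])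
  then have "b \<in> (\<Inter>a\<in>A. (+) a ` C) \<longleftrightarrow> (\<forall>a\<in>A. b - a \<in> C)" for b by blast
  then show ?thesis unfolding p_le_def by blast
qed

text \<open>A single \<open>b\<close> witnesses the relation, so \<open>B\<close> can later be
  shrunk to the singleton \<open>{b}\<close>.\<close>

lemma p_less_iff:
  "p_less C A B \<longleftrightarrow> (\<exists>b\<in>B. \<exists>z. (\<forall>a\<in>A. z - a \<in> C) \<and> b - z \<in> interior C)"
proof -
  have up: "z \<in> (\<Inter>a\<in>A. (+) a ` C) \<longleftrightarrow> (\<forall>a\<in>A. z - a \<in> C)" for z
    by (auto simp: image_iff intro!: bexI[of _ "z - _"])
  have "b \<in> (\<Inter>a\<in>A. (+) a ` C) + interior C \<longleftrightarrow>
      (\<exists>z. (\<forall>a\<in>A. z - a \<in> C) \<and> b - z \<in> interior C)" for b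
  proof
    assume "b \<in> (\<Inter>a\<in>A. (+) a ` C) + interior C"
    then obtain z c where "z \<in> (\<Inter>a\<in>A. (+) a ` C)" "c \<in> interior C" "b = z + c"
      by (rule set_plus_elim)
    then show "\<exists>z. (\<forall>a\<in>A. z - a \<in> C) \<and> b - z \<in> interior C"
      using up by (intro exI[of _ z]) auto
  next
    assume "\<exists>z. (\<forall>a\<in>A. z - a \<in> C) \<and> b - z \<in> interior C"
    then obtain z where "z \<in> (\<Inter>a\<in>A. (+) a ` C)" "b - z \<in> interior C" using up by blast
    then have "z + (b - z) \<in> (\<Inter>a\<in>A. (+) a ` C) + interior C" by (rule set_plus_intro)
    then show "b \<in> (\<Inter>a\<in>A. (+) a ` C) + interior C" by simp
  qed
  then show ?thesis unfolding p_less_def by blast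
qed

section \<open>The order of a solid cone and its order unit\<close>

locale solid_cone =
  fixes C :: "'b::real_normed_vector set" and e :: 'b
  assumes cone: "cone C" and convex: "convex C"
    and e_interior: "e \<in> interior C" and minus_e: "- e \<notin> C"
begin

lemma add_mem: "x \<in> C \<Longrightarrow> y \<in> C \<Longrightarrow> x + y \<in> C"
  using cone convex convex_cone by blast

lemma scale_mem: "x \<in> C \<Longrightarrow> 0 \<le> c \<Longrightarrow> c *\<^sub>R x \<in> C"
  using cone unfolding cone_def by blast

lemma le_trans: "y - x \<in> C \<Longrightarrow> z - y \<in> C \<Longrightarrow> z - x \<in> C"
  using add_mem[of "y - x" "z - y"] by simp

lemma e_mem: "e \<in> C"
  using e_interior interior_subset by blast

lemma zero_mem: "0 \<in> C"
  using scale_mem[OF e_mem, of 0] by simp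

text \<open>This is the form in which pointedness acts: a negative multiple of \<open>e\<close> in
  \<open>C\<close> would rescale to \<open>- e\<close>.\<close>

lemma scale_e_mem_iff: "t *\<^sub>R e \<in> C \<longleftrightarrow> 0 \<le> t"
proof
  assume mem: "t *\<^sub>R e \<in> C"
  show "0 \<le> t"
  proof (rule ccontr)
    assume "\<not> 0 \<le> t"
    with scale_mem[OF mem, of "inverse (- t)"] have "- e \<in> C" by (simp add: field_simps)
    with minus_e show False by blast
  qed
qed (rule scale_mem[OF e_mem])

text \<open>\<open>L\<close> is the radius of a ball around \<open>e\<close> inside
  \<open>C\<close>: for \<open>t > 0\<close> the point \<open>e - y /\<^sub>R t\<close> lies in that
  ball, and scaling by \<open>t\<close> gives the claim.\<close>

lemma order_unit: "\<exists>L>0. \<forall>y t. norm y \<le> L * t \<longrightarrow> t *\<^sub>R e - y \<in> C"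
proof -
  obtain r where r: "r > 0" "cball e r \<subseteq> C"
    using e_interior by (metis mem_interior_cball)
  have "t *\<^sub>R e - y \<in> C" if y: "norm y \<le> r * t" for y t
  proof (cases "t > 0")
    case True
    have "dist e (e - y /\<^sub>R t) = norm y / t" using True by (simp add: dist_norm divide_inverse)
    also have "\<dots> \<le> r" using y True by (simp add: field_simps)
    finally have "e - y /\<^sub>R t \<in> C" using r(2) by auto
    from scale_mem[OF this, of t] True show ?thesis by (simp add: scaleR_diff_right)
  next
    case False
    with y r have "norm y \<le> 0" "t = 0"
      by (smt (verit) norm_ge_zero mult_nonneg_nonpos zero_le_mult_iff)+
    then show ?thesis using zero_mem by simp
  qed
  then show ?thesis using r(1) by blast
qed

lemma order_unit_bound: "\<exists>t. t *\<^sub>R e - y \<in> C"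
proof -
  obtain L where L: "L > 0" "\<forall>y t. norm y \<le> L * t \<longrightarrow> t *\<^sub>R e - y \<in> C"
    using order_unit by blast
  from L(2)[rule_format, of y "norm y / L"] L(1) show ?thesis by auto
qed

lemma interior_dominates:
  assumes "p \<in> interior C"
  shows "\<exists>t>0. p - t *\<^sub>R e \<in> C"
proof -
  obtain r where r: "r > 0" "cball p r \<subseteq> C" using assms by (metis mem_interior_cball)
  have "norm e > 0" using minus_e zero_mem by auto
  with r show ?thesis by (intro exI[of _ "r / norm e"]) (auto simp: dist_norm)
qed

text \<open>Makes the strict relation quantitative: the gap \<open>t\<close> along \<open>e\<close>
  is uniform over \<open>A\<close>.\<close>

lemma p_less_scaleE:
  assumes "p_less C A B"
  obtains b t where "b \<in> B" "t > 0" "\<And>a. a \<in> A \<Longrightarrow> b - t *\<^sub>R e - a \<in> C"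
proof -
  obtain b z where z: "b \<in> B" "\<forall>a\<in>A. z - a \<in> C" "b - z \<in> interior C"
    using assms unfolding p_less_iff by blast
  obtain t where t: "t > 0" "b - z - t *\<^sub>R e \<in> C" using interior_dominates[OF z(3)] by blast
  have "b - t *\<^sub>R e - a \<in> C" if "a \<in> A" for a
    using add_mem[OF t(2), of "z - a"] z(2) that by (simp add: algebra_simps)
  with t(1) z(1) that show thesis by blast
qed

lemma p_less_imp_p_le: "p_less C A B \<Longrightarrow> p_le C A B"
proof (erule p_less_scaleE)
  fix b t assume b: "b \<in> B" "t > 0" "\<And>a. a \<in> A \<Longrightarrow> b - t *\<^sub>R e - a \<in> C"
  have "b - a \<in> C" if "a \<in> A" for a
    using add_mem[OF b(3)[OF that] scale_mem[OF e_mem, of t]] b(2) by simp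
  with b(1) show ?thesis unfolding p_le_iff by blast
qed

lemma p_less_p_le_asym: "p_less C A B \<Longrightarrow> \<not> p_le C B A"
proof (erule p_less_scaleE)
  fix b t assume b: "b \<in> B" "t > 0" "\<And>a. a \<in> A \<Longrightarrow> b - t *\<^sub>R e - a \<in> C"
  show ?thesis
  proof
    assume "p_le C B A"
    \<comment> \<open>If \<open>B = A\<close>, the choice \<open>a = b\<close> works; otherwise
      \<open>a\<close> is an upper bound of \<open>B\<close>.\<close>
    then obtain a where a: "a \<in> A" "a - b \<in> C"
      unfolding p_le_iff using b(1) zero_mem by force
    from add_mem[OF b(3)[OF a(1)] a(2)] have "(- t) *\<^sub>R e \<in> C" by simp
    with b(2) show False unfolding scale_e_mem_iff by simp
  qed
qed

text \<open>Balls of integer radius cover \<open>A\<close>. Finitely many suffice, and one multiple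
  of \<open>e\<close> dominates the largest of them.\<close>

lemma neg_cone_compact_bounded:
  assumes "neg_cone_compact C A"
  obtains u where "\<And>a. a \<in> A \<Longrightarrow> u - a \<in> C"
proof -
  obtain L where L: "L > 0" "\<forall>y t. norm y \<le> L * t \<longrightarrow> t *\<^sub>R e - y \<in> C"
    using order_unit by blast
  let ?\<U> = "range (\<lambda>n::nat. ball (0::'b) (real n))"
  have "A \<subseteq> (\<Union>U\<in>?\<U>. U + uminus ` C)"
  proof
    fix a assume "a \<in> A"
    obtain n :: nat where "norm a < real n" using reals_Archimedean2 by blast
    then have "a \<in> ball 0 (real n) + uminus ` C"
      unfolding neg_cone_sum_iff using zero_mem by (intro bexI[of _ a]) auto
    then show "a \<in> (\<Union>U\<in>?\<U>. U + uminus ` C)" by blast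
  qed
  then obtain \<V> where \<V>: "\<V> \<subseteq> ?\<U>" "finite \<V>" "A \<subseteq> (\<Union>U\<in>\<V>. U + uminus ` C)"
    using assms unfolding neg_cone_compact_def by (metis (no_types, lifting) image_iff open_ball)
  from \<V>(1,2) obtain D where D: "finite D" "\<V> = (\<lambda>n::nat. ball (0::'b) (real n)) ` D"
    by (meson finite_subset_image)
  \<comment> \<open>Inserting 0 keeps the maximum defined when \<open>D\<close> is empty.\<close>
  define m where "m = Max (insert 0 D)"
  have "(real m / L) *\<^sub>R e - a \<in> C" if "a \<in> A" for a
  proof -
    obtain n where n: "n \<in> D" "a \<in> ball 0 (real n) + uminus ` C"
      using \<V>(3) \<open>a \<in> A\<close> unfolding D by blast
    from n(2) obtain v where v: "v \<in> ball 0 (real n)" "v - a \<in> C"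
      unfolding neg_cone_sum_iff by blast
    have "n \<le> m" unfolding m_def using D(1) n(1) by simp
    then have "norm v \<le> L * (real m / L)" using v(1) L(1) by simp
    with L(2) have "(real m / L) *\<^sub>R e - v \<in> C" by blast
    with v(2) show ?thesis by (rule le_trans)
  qed
  with that show thesis by blast
qed

section \<open>Monotone convex functionals normalised along \<open>e\<close>\<close>

definition scalarizer :: "('b \<Rightarrow> real) \<Rightarrow> bool" where
  "scalarizer \<psi> \<longleftrightarrow> convex_on UNIV \<psi> \<and> (\<forall>x y. y - x \<in> C \<longrightarrow> \<psi> x \<le> \<psi> y) \<and>
     (\<forall>y r. \<psi> (y + r *\<^sub>R e) = \<psi> y + r)"

lemma scalarizer_mono: "scalarizer \<psi> \<Longrightarrow> y - x \<in> C \<Longrightarrow> \<psi> x \<le> \<psi> y"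
  unfolding scalarizer_def by blast

lemma scalarizer_shift: "scalarizer \<psi> \<Longrightarrow> \<psi> (y - r *\<^sub>R e) = \<psi> y - r"
  unfolding scalarizer_def by (metis diff_conv_add_uminus scaleR_minus_left)

text \<open>Allows the functionals of two solutions to be joined by a segment; the class
  \<open>scalarizer\<close> is kept abstract for this purpose.\<close>

lemma scalarizer_combination:
  assumes "scalarizer \<psi>" "scalarizer \<theta>" "0 \<le> s" "s \<le> 1"
  shows "scalarizer (\<lambda>y. (1 - s) * \<psi> y + s * \<theta> y)"
proof -
  have "convex_on UNIV (\<lambda>y. (1 - s) * \<psi> y + s * \<theta> y)"
    using assms unfolding scalarizer_def by (intro convex_on_add convex_on_cmul) auto
  moreover have "(1 - s) * \<psi> x + s * \<theta> x \<le> (1 - s) * \<psi> y + s * \<theta> y" if "y - x \<in> C" for x y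
    using assms that by (intro add_mono mult_left_mono scalarizer_mono) auto
  ultimately show ?thesis
    using assms unfolding scalarizer_def by (auto simp: algebra_simps)
qed

lemma scalarizer_bdd_above:
  assumes "scalarizer \<psi>" "neg_cone_compact C A"
  shows "bdd_above (\<psi> ` A)"
proof -
  obtain u where "\<And>a. a \<in> A \<Longrightarrow> u - a \<in> C" using neg_cone_compact_bounded assms(2) by blast
  then have "\<psi> a \<le> \<psi> u" if "a \<in> A" for a using assms(1) that scalarizer_mono by blast
  then show ?thesis by (intro bdd_aboveI2)
qed

text \<open>The Gerstewitz functional of \<open>B\<close> in direction \<open>e\<close>; it is meaningful when \<open>B\<close> is nonempty
  and bounded above, as otherwise the infimum is over an empty or unbounded set.\<close>

definition gerstewitz :: "'b set \<Rightarrow> 'b \<Rightarrow> real" where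
  "gerstewitz B y = Inf {t. \<exists>b\<in>B. b + t *\<^sub>R e - y \<in> C}"

context
  fixes B :: "'b set"
  assumes ne: "B \<noteq> {}" and compact: "neg_cone_compact C B"
begin

text \<open>Makes the infimum genuine: the order unit supplies an admissible \<open>t\<close>, and
  an upper bound of \<open>B\<close> keeps all admissible \<open>t\<close> above a fixed
  number.\<close>

lemma gerstewitz_set: "{t. \<exists>b\<in>B. b + t *\<^sub>R e - y \<in> C} \<noteq> {}"
  "bdd_below {t. \<exists>b\<in>B. b + t *\<^sub>R e - y \<in> C}"
proof -
  obtain b where b: "b \<in> B" using ne by blast
  obtain t where "t *\<^sub>R e - (y - b) \<in> C" using order_unit_bound by blast
  then have "b + t *\<^sub>R e - y \<in> C" by (simp add: algebra_simps)
  with b show "{t. \<exists>b\<in>B. b + t *\<^sub>R e - y \<in> C} \<noteq> {}" by blast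
next
  obtain u where u: "\<And>b. b \<in> B \<Longrightarrow> u - b \<in> C" using neg_cone_compact_bounded compact by blast
  obtain r where r: "r *\<^sub>R e - (u - y) \<in> C" using order_unit_bound by blast
  have "- r \<le> t" if "b \<in> B" "b + t *\<^sub>R e - y \<in> C" for b t
  proof -
    have "(u - b) + (b + t *\<^sub>R e - y) + (r *\<^sub>R e - (u - y)) \<in> C"
      using u that r add_mem by blast
    then have "(t + r) *\<^sub>R e \<in> C" by (simp add: algebra_simps)
    then show ?thesis unfolding scale_e_mem_iff by simp
  qed
  then show "bdd_below {t. \<exists>b\<in>B. b + t *\<^sub>R e - y \<in> C}" by (intro bdd_belowI) blast
qed

lemma gerstewitz_le: "b \<in> B \<Longrightarrow> b + t *\<^sub>R e - y \<in> C \<Longrightarrow> gerstewitz B y \<le> t"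
  unfolding gerstewitz_def using gerstewitz_set(2) by (intro cInf_lower) auto

lemma gerstewitz_greatest:
  "(\<And>b t. b \<in> B \<Longrightarrow> b + t *\<^sub>R e - y \<in> C \<Longrightarrow> r \<le> t) \<Longrightarrow> r \<le> gerstewitz B y"
  unfolding gerstewitz_def using gerstewitz_set(1) by (intro cInf_greatest) auto

lemma gerstewitz_lessD:
  assumes "gerstewitz B y < r"
  obtains b t where "b \<in> B" "b + t *\<^sub>R e - y \<in> C" "t < r"
  using cInf_lessD[OF gerstewitz_set(1)] assms that unfolding gerstewitz_def by blast

lemma gerstewitz_self: "b \<in> B \<Longrightarrow> gerstewitz B b \<le> 0"
  using gerstewitz_le[of b 0 b] zero_mem by simp

text \<open>Some admissible \<open>t\<close> is negative, and adding
  \<open>(- t) *\<^sub>R e\<close> removes the shift. Contrapositively, points outside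
  \<open>B - C\<close> have nonnegative value.\<close>

lemma gerstewitz_neg:
  assumes "gerstewitz B y < 0"
  shows "\<exists>b\<in>B. b - y \<in> C"
proof -
  obtain b t where b: "b \<in> B" "b + t *\<^sub>R e - y \<in> C" "t < 0" using assms by (rule gerstewitz_lessD)
  with add_mem[OF b(2), of "(- t) *\<^sub>R e"] show ?thesis
    using scale_mem[OF e_mem, of "- t"] by (intro bexI[of _ b]) auto
qed

lemma scalarizer_gerstewitz:
  assumes "neg_cone_convex C B"
  shows "scalarizer (gerstewitz B)"
proof -
  \<comment> \<open>The reverse inequality is this one at the shifted point with
    \<open>- r\<close>.\<close>
  have shift_le: "gerstewitz B (y + r *\<^sub>R e) \<le> gerstewitz B y + r" for y r
  proof -
    have "gerstewitz B (y + r *\<^sub>R e) - r \<le> gerstewitz B y"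
    proof (rule gerstewitz_greatest)
      fix b t assume "b \<in> B" "b + t *\<^sub>R e - y \<in> C"
      then show "gerstewitz B (y + r *\<^sub>R e) - r \<le> t"
        using gerstewitz_le[of b "t + r" "y + r *\<^sub>R e"] by (simp add: algebra_simps)
    qed
    then show ?thesis by simp
  qed
  have "gerstewitz B (y + r *\<^sub>R e) = gerstewitz B y + r" for y r
    using shift_le[of y r] shift_le[of "y + r *\<^sub>R e" "- r"] by simp
  moreover have "gerstewitz B x \<le> gerstewitz B y" if "y - x \<in> C" for x y
  proof (rule gerstewitz_greatest)
    fix b t assume "b \<in> B" "b + t *\<^sub>R e - y \<in> C"
    then show "gerstewitz B x \<le> t" using gerstewitz_le le_trans that by blast
  qed
  moreover have "convex_on UNIV (gerstewitz B)"
  proof (rule convex_onI)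
    fix l :: real and x y :: 'b
    assume l: "0 < l" "l < 1"
    show "gerstewitz B ((1 - l) *\<^sub>R x + l *\<^sub>R y)
        \<le> (1 - l) * gerstewitz B x + l * gerstewitz B y"
    \<comment> \<open>The infima need not be attained, so almost optimal \<open>t\<close> and
      \<open>s\<close> are combined.\<close>
    proof (rule field_le_epsilon)
      fix \<epsilon> :: real assume \<epsilon>: "\<epsilon> > 0"
      obtain b t where b: "b \<in> B" "b + t *\<^sub>R e - x \<in> C" "t < gerstewitz B x + \<epsilon>"
        using gerstewitz_lessD[of x "gerstewitz B x + \<epsilon>"] \<epsilon> by auto
      obtain d s where d: "d \<in> B" "d + s *\<^sub>R e - y \<in> C" "s < gerstewitz B y + \<epsilon>"
        using gerstewitz_lessD[of y "gerstewitz B y + \<epsilon>"] \<epsilon> by auto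
      have "b \<in> B + uminus ` C" "d \<in> B + uminus ` C"
        unfolding neg_cone_sum_iff using b d zero_mem by force+
      then have "(1 - l) *\<^sub>R b + l *\<^sub>R d \<in> B + uminus ` C"
        using assms l unfolding neg_cone_convex_def by (simp add: convexD)
      then obtain p where p: "p \<in> B" "p - ((1 - l) *\<^sub>R b + l *\<^sub>R d) \<in> C"
        unfolding neg_cone_sum_iff by blast
      \<comment> \<open>The first summand trades the combination of \<open>b\<close> and
        \<open>d\<close> for \<open>p\<close>, a point of \<open>B\<close> above it by convexity of
        \<open>B - C\<close>.\<close>
      have "(p - ((1 - l) *\<^sub>R b + l *\<^sub>R d))
          + ((1 - l) *\<^sub>R (b + t *\<^sub>R e - x) + l *\<^sub>R (d + s *\<^sub>R e - y)) \<in> C"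
        using p(2) b(2) d(2) l by (intro add_mem scale_mem) auto
      then have "p + ((1 - l) * t + l * s) *\<^sub>R e - ((1 - l) *\<^sub>R x + l *\<^sub>R y) \<in> C"
        by (simp add: algebra_simps)
      then have "gerstewitz B ((1 - l) *\<^sub>R x + l *\<^sub>R y) \<le> (1 - l) * t + l * s"
        using gerstewitz_le p(1) by blast
      also have "\<dots> \<le> (1 - l) * (gerstewitz B x + \<epsilon>) + l * (gerstewitz B y + \<epsilon>)"
        using l b(3) d(3) by (intro add_mono mult_left_mono) auto
      also have "\<dots> = (1 - l) * gerstewitz B x + l * gerstewitz B y + \<epsilon>"
        by (simp add: algebra_simps)
      finally show "gerstewitz B ((1 - l) *\<^sub>R x + l *\<^sub>R y)
        \<le> (1 - l) * gerstewitz B x + l * gerstewitz B y + \<epsilon>" .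
    qed
  qed simp
  ultimately show ?thesis unfolding scalarizer_def by blast
qed

end

text \<open>If \<open>u\<close> bounds \<open>B\<close> and \<open>M *\<^sub>R e\<close> bounds
  \<open>u - d\<close> for one \<open>d\<close> in \<open>D\<close>, every \<open>t\<close>
  admissible for \<open>B\<close> makes \<open>t + M\<close> admissible for \<open>D\<close>. This
  yields the Lipschitz constant along the path.\<close>

lemma gerstewitz_diff_bounded:
  assumes "B \<noteq> {}" "neg_cone_compact C B" "D \<noteq> {}" "neg_cone_compact C D"
  shows "\<exists>M. \<forall>y. gerstewitz D y \<le> gerstewitz B y + M"
proof -
  obtain u where u: "\<And>b. b \<in> B \<Longrightarrow> u - b \<in> C"
    using neg_cone_compact_bounded assms(2) by blast
  obtain d where d: "d \<in> D" using assms(3) by blast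
  obtain M where M: "M *\<^sub>R e - (u - d) \<in> C" using order_unit_bound by blast
  have "gerstewitz D y - M \<le> gerstewitz B y" for y
  proof (rule gerstewitz_greatest[OF assms(1,2)])
    fix b t assume b: "b \<in> B" "b + t *\<^sub>R e - y \<in> C"
    have "(M *\<^sub>R e - (u - d)) + ((u - b) + (b + t *\<^sub>R e - y)) \<in> C"
      using b u M add_mem by blast
    then have "d + (t + M) *\<^sub>R e - y \<in> C" by (simp add: algebra_simps)
    then show "gerstewitz D y - M \<le> t"
      using gerstewitz_le[OF assms(3,4) d, of "t + M" y] by simp
  qed
  then show ?thesis by (metis diff_le_eq)
qed

end

section \<open>Strictly convexlike maps\<close>

locale convexlike_map = solid_cone C e
  for C :: "'b::real_normed_vector set" and e +
  fixes K :: "'a::t2_space set" and F :: "'a \<Rightarrow> 'b set"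
  assumes K_ne: "K \<noteq> {}" and K_compact: "compact K"
    and lsc: "neg_cone_lsc_on C F K"
    and convexlike: "strictly_p_convexlike_on C F K"
    and F_ne: "x \<in> K \<Longrightarrow> F x \<noteq> {}"
    and F_convex: "x \<in> K \<Longrightarrow> neg_cone_convex C (F x)"
    and F_compact: "x \<in> K \<Longrightarrow> neg_cone_compact C (F x)"
begin

text \<open>The case \<open>t = 1/2\<close>, with the target set reduced to the one point that
  witnesses the strict relation.\<close>

lemma convexlike_midpoint:
  assumes "x \<in> K" "y \<in> K" "x \<noteq> y"
  obtains z a b where "z \<in> K" "a \<in> F x" "b \<in> F y"
    "p_less C (F z) {(1 / 2) *\<^sub>R a + (1 / 2) *\<^sub>R b}"
proof -
  obtain z where z: "z \<in> K" "p_less C (F z) ((*\<^sub>R) (1/2) ` F x + (*\<^sub>R) (1 - 1/2) ` F y)"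
    using convexlike[unfolded strictly_p_convexlike_on_def, rule_format, of x y "1/2"] assms
    by auto
  then obtain w where w: "w \<in> (*\<^sub>R) (1/2) ` F x + (*\<^sub>R) (1 - 1/2) ` F y" "p_less C (F z) {w}"
    unfolding p_less_iff by blast
  from w(1) obtain a b where "a \<in> F x" "b \<in> F y" "w = (1 / 2) *\<^sub>R a + (1 / 2) *\<^sub>R b"
    by (auto elim!: set_plus_elim)
  with z(1) w(2) that show thesis by blast
qed

lemma weak_p_minimal_iff:
  "x0 \<in> weak_p_minimal C F K \<longleftrightarrow> x0 \<in> K \<and> (\<forall>x\<in>K. \<not> p_less C (F x) (F x0))"
proof -
  have "\<not> p_less C B A" if "p_less C A B" for A B
    using p_less_p_le_asym[OF that] p_less_imp_p_le by blast
  then show ?thesis unfolding weak_p_minimal_def by blast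
qed

text \<open>If \<open>F x\<close> lay in the convex set \<open>F x0 - C\<close>, so would the
  midpoint \<open>?q\<close>. Some \<open>p\<close> in \<open>F x0\<close> would dominate it,
  putting \<open>F z\<close> strictly below \<open>F x0\<close>.\<close>

lemma weak_p_minimal_not_dominated:
  assumes x0: "x0 \<in> weak_p_minimal C F K" and x: "x \<in> K" "x \<noteq> x0"
  shows "\<exists>a\<in>F x. \<forall>b\<in>F x0. b - a \<notin> C"
proof (rule ccontr)
  assume "\<not> ?thesis"
  then have below: "\<forall>a\<in>F x. a \<in> F x0 + uminus ` C" unfolding neg_cone_sum_iff by blast
  have "x0 \<in> K" using x0 weak_p_minimal_iff by blast
  then obtain z a b where z: "z \<in> K" "a \<in> F x" "b \<in> F x0"
      "p_less C (F z) {(1 / 2) *\<^sub>R a + (1 / 2) *\<^sub>R b}"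
    using convexlike_midpoint x by metis
  have "b \<in> F x0 + uminus ` C" unfolding neg_cone_sum_iff using z(3) zero_mem by force
  then have "(1 / 2) *\<^sub>R a + (1 / 2) *\<^sub>R b \<in> F x0 + uminus ` C"
    using below z(2) F_convex[OF \<open>x0 \<in> K\<close>] unfolding neg_cone_convex_def by (simp add: convexD)
  then obtain p where p: "p \<in> F x0" "p - ((1 / 2) *\<^sub>R a + (1 / 2) *\<^sub>R b) \<in> C"
    unfolding neg_cone_sum_iff by blast
  let ?q = "(1 / 2) *\<^sub>R a + (1 / 2) *\<^sub>R b"
  obtain w where w: "\<forall>c\<in>F z. w - c \<in> C" "?q - w \<in> interior C"
    using z(4) unfolding p_less_iff by blast
  \<comment> \<open>The bound \<open>w\<close> is raised by the cone element \<open>p - ?q\<close>,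
    so its distance to \<open>p\<close> is still \<open>?q - w\<close>.\<close>
  have "(p - ?q + w) - c \<in> C" if "c \<in> F z" for c
    using add_mem[OF p(2), of "w - c"] w(1) that by (simp add: algebra_simps)
  moreover have "p - (p - ?q + w) \<in> interior C" using w(2) by (simp add: algebra_simps)
  ultimately have "p_less C (F z) (F x0)" unfolding p_less_iff using p(1) by blast
  with x0 z(1) show False unfolding weak_p_minimal_iff by blast
qed

text \<open>One inclusion is asymmetry of the strict relation. For the other, a weakly minimal
  \<open>x0\<close> has no predecessor in \<open>K\<close> but itself.\<close>

lemma p_minimal_eq: "p_minimal C F K = weak_p_minimal C F K"
proof (intro set_eqI iffI)
  fix x0 assume "x0 \<in> p_minimal C F K"
  then show "x0 \<in> weak_p_minimal C F K"
    unfolding weak_p_minimal_iff p_minimal_def using p_less_p_le_asym p_less_imp_p_le by blast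
next
  fix x0 assume x0: "x0 \<in> weak_p_minimal C F K"
  have "x = x0" if x: "x \<in> K" "p_le C (F x) (F x0)" for x
  proof (rule ccontr)
    assume "x \<noteq> x0"
    then obtain a where a: "a \<in> F x" "\<forall>b\<in>F x0. b - a \<notin> C"
      using weak_p_minimal_not_dominated x0 x(1) by blast
    with x(2) have "F x = F x0" unfolding p_le_iff by blast
    with a zero_mem show False by force
  qed
  then show "x0 \<in> p_minimal C F K"
    using x0 unfolding weak_p_minimal_iff p_minimal_def p_le_iff by blast
qed

section \<open>The largest scalarised value on \<open>F x\<close>\<close>

definition worst :: "('b \<Rightarrow> real) \<Rightarrow> 'a \<Rightarrow> real" where
  "worst \<psi> x = (SUP a\<in>F x. \<psi> a)"

lemma worst_upper: "scalarizer \<psi> \<Longrightarrow> x \<in> K \<Longrightarrow> a \<in> F x \<Longrightarrow> \<psi> a \<le> worst \<psi> x"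
  unfolding worst_def by (intro cSUP_upper scalarizer_bdd_above F_compact)

lemma worst_least: "x \<in> K \<Longrightarrow> (\<And>a. a \<in> F x \<Longrightarrow> \<psi> a \<le> r) \<Longrightarrow> worst \<psi> x \<le> r"
  unfolding worst_def using F_ne by (intro cSUP_least)

text \<open>The gap \<open>t\<close> is uniform over \<open>F x\<close>, so strictness survives the
  supremum.\<close>

lemma worst_less:
  assumes "scalarizer \<psi>" "x \<in> K" "p_less C (F x) {b}"
  shows "worst \<psi> x < \<psi> b"
proof -
  obtain t where t: "t > 0" "\<And>a. a \<in> F x \<Longrightarrow> b - t *\<^sub>R e - a \<in> C"
    using p_less_scaleE[OF assms(3)] by blast
  have "worst \<psi> x \<le> \<psi> b - t"
  proof (rule worst_least[OF assms(2)])
    fix a assume "a \<in> F x"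
    from scalarizer_mono[OF assms(1) t(2)[OF this]] show "\<psi> a \<le> \<psi> b - t"
      using scalarizer_shift[OF assms(1)] by simp
  qed
  with t(1) show ?thesis by simp
qed

text \<open>Near \<open>x\<close>, each \<open>F u\<close> contains a point \<open>v + c\<close>
  with \<open>v\<close> close to some \<open>a\<close> of large value; \<open>c\<close> cannot lower
  the value.\<close>

lemma worst_lsc:
  assumes "scalarizer \<psi>"
  shows "lsc_on K (worst \<psi>)"
  unfolding lsc_on_def
proof (intro ballI allI impI)
  fix x r assume x: "x \<in> K" "r < worst \<psi> x"
  obtain a where a: "a \<in> F x" "r < \<psi> a"
    using worst_least[OF x(1)] x(2) by (metis not_le)
  define \<epsilon> where "\<epsilon> = (\<psi> a - r) / 2"
  have \<epsilon>: "\<epsilon> > 0" "r < \<psi> a - \<epsilon>" unfolding \<epsilon>_def using a(2) by (auto simp: field_simps)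
  obtain L where L: "L > 0" "\<forall>y t. norm y \<le> L * t \<longrightarrow> t *\<^sub>R e - y \<in> C"
    using order_unit by blast
  \<comment> \<open>With this radius, replacing \<open>a\<close> by \<open>v\<close> costs at most
    \<epsilon> in value.\<close>
  have "open (ball a (L * \<epsilon>)) \<and> a \<in> ball a (L * \<epsilon>)" using L(1) \<epsilon>(1) by simp
  then obtain N where N: "open N" "x \<in> N" "\<forall>u\<in>N. F u \<inter> (ball a (L * \<epsilon>) + C) \<noteq> {}"
    using lsc x(1) a(1) unfolding neg_cone_lsc_on_def neg_cone_lsc_at_def by meson
  have "r < worst \<psi> u" if u: "u \<in> N" "u \<in> K" for u
  proof -
    obtain v c where v: "v \<in> ball a (L * \<epsilon>)" "c \<in> C" "v + c \<in> F u"
      using N(3) u(1) by (blast elim: set_plus_elim)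
    have "norm (a - v) \<le> L * \<epsilon>" using v(1) by (simp add: dist_norm)
    with L(2) have "\<epsilon> *\<^sub>R e - (a - v) \<in> C" by blast
    from add_mem[OF this v(2)] have "(v + c) - (a - \<epsilon> *\<^sub>R e) \<in> C" by (simp add: algebra_simps)
    from scalarizer_mono[OF assms this] have "\<psi> a - \<epsilon> \<le> \<psi> (v + c)"
      using scalarizer_shift[OF assms] by simp
    also have "\<dots> \<le> worst \<psi> u" using worst_upper assms u(2) v(3) by blast
    finally show ?thesis using \<epsilon>(2) by simp
  qed
  with N(1,2) show "\<exists>N. open N \<and> x \<in> N \<and> (\<forall>u\<in>N \<inter> K. r < worst \<psi> u)" by blast
qed

text \<open>By convexity of \<psi>, the point \<open>z\<close> that convexlikeness assigns to two
  minimisers would have a smaller value than both.\<close>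

lemma worst_minimizer_unique:
  assumes \<psi>: "scalarizer \<psi>" and x: "x \<in> K" "\<forall>u\<in>K. worst \<psi> x \<le> worst \<psi> u"
    and y: "y \<in> K" "y \<noteq> x"
  shows "worst \<psi> x < worst \<psi> y"
proof (rule ccontr)
  assume "\<not> ?thesis"
  then have eq: "worst \<psi> y = worst \<psi> x" using x(2) y(1) by force
  obtain z a b where z: "z \<in> K" "a \<in> F x" "b \<in> F y"
      "p_less C (F z) {(1 / 2) *\<^sub>R a + (1 / 2) *\<^sub>R b}"
    using convexlike_midpoint x(1) y by metis
  have "worst \<psi> z < \<psi> ((1 / 2) *\<^sub>R a + (1 / 2) *\<^sub>R b)" using worst_less \<psi> z by blast
  also have "\<dots> \<le> (1 / 2) * \<psi> a + (1 / 2) * \<psi> b"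
    using \<psi> convex_onD[of UNIV \<psi> "1/2" a b] unfolding scalarizer_def by simp
  also have "\<dots> \<le> worst \<psi> x"
    using worst_upper[OF \<psi> x(1) z(2)] worst_upper[OF \<psi> y(1) z(3)] eq by simp
  finally show False using x(2) z(1) by force
qed

lemma worst_minimizer_weak_p_minimal:
  assumes "scalarizer \<psi>" "x \<in> K" "\<forall>u\<in>K. worst \<psi> x \<le> worst \<psi> u"
  shows "x \<in> weak_p_minimal C F K"
  unfolding weak_p_minimal_iff
proof (intro conjI ballI notI)
  fix u assume u: "u \<in> K" "p_less C (F u) (F x)"
  then obtain b where b: "b \<in> F x" "p_less C (F u) {b}" unfolding p_less_iff by blast
  from worst_less[OF assms(1) u(1) b(2)] worst_upper[OF assms(1,2) b(1)] assms(3) u(1)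
  show False by force
qed (fact assms(2))

text \<open>The value 0 separates: all of \<open>F x\<close> lies at or below it, while
  \<open>F u\<close> has an undominated point at or above it.\<close>

lemma weak_p_minimal_minimizes_worst:
  assumes x: "x \<in> weak_p_minimal C F K" and u: "u \<in> K"
  shows "worst (gerstewitz (F x)) x \<le> worst (gerstewitz (F x)) u"
proof (cases "u = x")
  case False
  have xK: "x \<in> K" using x weak_p_minimal_iff by blast
  note F_x = F_ne[OF xK] F_compact[OF xK]
  have scal: "scalarizer (gerstewitz (F x))"
    using scalarizer_gerstewitz F_x F_convex xK by blast
  obtain a where a: "a \<in> F u" "\<forall>b\<in>F x. b - a \<notin> C"
    using weak_p_minimal_not_dominated x u False by blast
  have "worst (gerstewitz (F x)) x \<le> 0"
    using gerstewitz_self[OF F_x] by (rule worst_least[OF xK])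
  also have "0 \<le> gerstewitz (F x) a"
    using gerstewitz_neg[OF F_x, of a] a(2) by (meson not_le)
  also have "\<dots> \<le> worst (gerstewitz (F x)) u" using worst_upper scal u a(1) by blast
  finally show ?thesis .
qed simp

lemma weak_p_minimal_ne: "weak_p_minimal C F K \<noteq> {}"
proof -
  obtain x where x: "x \<in> K" using K_ne by blast
  have scal: "scalarizer (gerstewitz (F x))"
    using scalarizer_gerstewitz F_ne F_compact F_convex x by blast
  show ?thesis
    using lsc_on_attains_inf[OF K_compact K_ne worst_lsc[OF scal]]
      worst_minimizer_weak_p_minimal[OF scal] by blast
qed

section \<open>The path of minimisers\<close>

lemma path_connected_weak_p_minimal: "path_connected (weak_p_minimal C F K)"
  unfolding path_connected_def
proof (intro ballI)
  fix x y assume x: "x \<in> weak_p_minimal C F K" and y: "y \<in> weak_p_minimal C F K"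
  then have K: "x \<in> K" "y \<in> K" by (simp_all add: weak_p_minimal_iff)
  define \<psi> where "\<psi> s p = (1 - s) * gerstewitz (F x) p + s * gerstewitz (F y) p" for s :: real and p
  have scal: "scalarizer (\<psi> s)" if "s \<in> {0..1}" for s
    unfolding \<psi>_def using that K
    by (intro scalarizer_combination scalarizer_gerstewitz F_ne F_compact F_convex) auto
  have "\<exists>m\<in>K. \<forall>u\<in>K. worst (\<psi> s) m \<le> worst (\<psi> s) u" if "s \<in> {0..1}" for s
    using lsc_on_attains_inf[OF K_compact K_ne worst_lsc[OF scal[OF that]]] .
  then obtain m where m: "\<And>s. s \<in> {0..1} \<Longrightarrow> m s \<in> K"
    "\<And>s. s \<in> {0..1} \<Longrightarrow> \<forall>u\<in>K. worst (\<psi> s) (m s) \<le> worst (\<psi> s) u" by metis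
  have unique: "m s = u" if "s \<in> {0..1}" "u \<in> K" "\<forall>v\<in>K. worst (\<psi> s) u \<le> worst (\<psi> s) v" for s u
    using worst_minimizer_unique[OF scal[OF that(1)] that(2,3) m(1)[OF that(1)]] m(2)[OF that(1)]
      that(2) by force
  obtain M1 where M1: "\<And>p. gerstewitz (F x) p \<le> gerstewitz (F y) p + M1"
    using gerstewitz_diff_bounded K F_ne F_compact by meson
  obtain M2 where M2: "\<And>p. gerstewitz (F y) p \<le> gerstewitz (F x) p + M2"
    using gerstewitz_diff_bounded K F_ne F_compact by meson
  \<comment> \<open>The two one-sided bounds together bound the absolute difference.\<close>
  define M where "M = max M1 M2"
  have lipschitz: "\<psi> s p \<le> \<psi> t p + M * \<bar>s - t\<bar>" for s t p
  proof -
    have "\<psi> s p - \<psi> t p = (gerstewitz (F y) p - gerstewitz (F x) p) * (s - t)"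
      unfolding \<psi>_def by (simp add: algebra_simps)
    also have "\<dots> \<le> \<bar>gerstewitz (F y) p - gerstewitz (F x) p\<bar> * \<bar>s - t\<bar>"
      by (metis abs_ge_self abs_mult)
    also have "\<dots> \<le> M * \<bar>s - t\<bar>"
      unfolding M_def using M1[of p] M2[of p] by (intro mult_right_mono) auto
    finally show ?thesis by simp
  qed
  have "continuous_on {0..1} m"
  proof (rule continuous_on_argmin[OF K_compact, where g = "\<lambda>s. worst (\<psi> s)"])
    fix s t :: real and u assume s: "s \<in> {0..1}" and t: "t \<in> {0..1}" and u: "u \<in> K"
    show "worst (\<psi> s) u \<le> worst (\<psi> t) u + M * \<bar>s - t\<bar>"
    proof (rule worst_least[OF u])
      fix a assume "a \<in> F u"
      from worst_upper[OF scal[OF t] u this] lipschitz[of s a t]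
      show "\<psi> s a \<le> worst (\<psi> t) u + M * \<bar>s - t\<bar>" by simp
    qed
  next
    fix s :: real assume s: "s \<in> {0..1}"
    show "lsc_on K (worst (\<psi> s))" using worst_lsc scal[OF s] by blast
    show "m s \<in> K \<and> (\<forall>x\<in>K. x \<noteq> m s \<longrightarrow> worst (\<psi> s) (m s) < worst (\<psi> s) x)"
      using worst_minimizer_unique[OF scal[OF s] m(1)[OF s] m(2)[OF s]] m(1)[OF s] by blast
  qed
  moreover have "m s \<in> weak_p_minimal C F K" if "s \<in> {0..1}" for s
    using worst_minimizer_weak_p_minimal scal m that by blast
  moreover have "\<psi> 0 = gerstewitz (F x)" "\<psi> 1 = gerstewitz (F y)"
    unfolding \<psi>_def by auto
  \<comment> \<open>Each endpoint minimises the objective of its own functional, and minimisers are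
    unique.\<close>
  then have "m 0 = x" "m 1 = y"
    using weak_p_minimal_minimizes_worst[OF x] weak_p_minimal_minimizes_worst[OF y] K
    by (auto intro!: unique)
  ultimately show "\<exists>g. path g \<and> path_image g \<subseteq> weak_p_minimal C F K
      \<and> pathstart g = x \<and> pathfinish g = y"
    by (intro exI[of _ m]) (auto simp: path_def path_image_def pathstart_def pathfinish_def)
qed

end

theorem theorem5p1:
  fixes C :: "'b::banach set"
    and K :: "'a::real_normed_vector set"
    and F :: "'a \<Rightarrow> 'b set"
  assumes Y_nontrivial: "\<exists>y::'b. y \<noteq> 0"
    and "cone C" and "convex C" and "closed C" and "pointed C" and "interior C \<noteq> {}"
    and "K \<noteq> {}" and "compact K"
    and "neg_cone_lsc_on C F K"
    and "strictly_p_convexlike_on C F K"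
    and "\<And>x. x \<in> K \<Longrightarrow> F x \<noteq> {} \<and> neg_cone_convex C (F x) \<and> neg_cone_compact C (F x)"
  shows "arcwise_connected (weak_p_minimal C F K) \<and> arcwise_connected (p_minimal C F K)"
proof -
  obtain e where e: "e \<in> interior C" using assms(6) by blast
  \<comment> \<open>Were 0 interior to \<open>C\<close>, a short nonzero vector and its negative
    would both lie in \<open>C\<close>, against pointedness.\<close>
  have "e \<noteq> 0"
  proof
    assume "e = 0"
    with e obtain r where r: "r > 0" "cball 0 r \<subseteq> C" by (metis mem_interior_cball)
    obtain y :: 'b where y: "y \<noteq> 0" using Y_nontrivial by blast
    define z where "z = (r / norm y) *\<^sub>R y"
    have "norm z = r" "z \<noteq> 0" unfolding z_def using y r(1) by auto
    then have "z \<in> C" "- z \<in> C" using r by auto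
    then have "z \<in> C \<inter> uminus ` C" by (metis IntI image_eqI minus_minus)
    with \<open>z \<noteq> 0\<close> show False using assms(5) unfolding pointed_def by blast
  qed
  have "- e \<notin> C"
  proof
    assume "- e \<in> C"
    then have "e \<in> uminus ` C" by (metis image_eqI minus_minus)
    moreover have "e \<in> C" using e interior_subset by blast
    ultimately show False using assms(5) \<open>e \<noteq> 0\<close> unfolding pointed_def by blast
  qed
  then interpret convexlike_map C e K F
    using assms e by unfold_locales auto
  show ?thesis
    unfolding arcwise_connected_def p_minimal_eq
    using weak_p_minimal_ne path_connected_weak_p_minimal by blast
qed

end
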